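(* Let $d\ge1$ and let $c_1(d)>0$, $c_2(d)\ge1$, $c_3(d)>0$ be constants depending on the dimension only. Suppose $p\in\mathcal{C}(c_1(d),c_2(d),c_3(d))$ and let $\sigma:=\det(\mathrm{Cov}(p))^{1/(2d)}$. For $n\ge1$ let $p_n:=p*\cdots*p$ be the $n$-fold convolution of $p$ with itself. Then $$p_n\in\mathcal{C}\bigl(n^{d/2}c_1(d),\,n^{d/2}c_2'(d,n),\,\sqrt n\,c_3(d)\bigr)$$ for some constant $c_2'(d,n)$ depending on the dimension and $n$. That is: (1) $\max_{k\in\mathbb{Z}^d}p_n(k)\le \frac{c_1(d)}{\sigma^d}$; (2) for all $k\in\mathbb{Z}^d$ with $\|k\|_\infty\ge c_2'(d,n)\sigma$, $p_n(k)\le\frac{c_2'(d,n)}{\sigma^d}e^{-\frac{\|k\|_1}{c_2'(d,n)\sigma}}$, where in fact one may take $c_2'(d,n)=\bigl(3\cdot4^{d+1}c_2(d)\bigr)^{2^n-1}$; (3) $\sum_{i=1}^d\sum_{k\in\mathbb{Z}^d}|p_n(k)-p_n(k-e_i)|\le\frac{c_3(d)}{\sigma}$.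
   Context: For a p.m.f. $p$ on $\mathbb{Z}^d$ with finite second moments, $\mathrm{Cov}(p)$ is its usual covariance matrix. $e_1,\dots,e_d$ is the standard basis of $\mathbb{Z}^d$. The class $\mathcal{C}(c_1,c_2,c_3)$ is the set of p.m.f.s $q$ on $\mathbb{Z}^d$ (with finite covariance and $\sigma_q>0$) such that, with $\sigma_q:=\det(\mathrm{Cov}(q))^{1/(2d)}$: (i) $\max_{k}q(k)\le c_1/\sigma_q^d$; (ii) for all $k\in\mathbb{Z}^d$ with $\|k\|_\infty\ge c_2\sigma_q$, $q(k)\le \frac{c_2}{\sigma_q^d}e^{-\|k\|_1/(c_2\sigma_q)}$; (iii) $\sum_{i=1}^d\sum_{k\in\mathbb{Z}^d}|q(k)-q(k-e_i)|\le c_3/\sigma_q$. *)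

theory Defs
  imports "HOL-Probability.Probability"
begin

text \<open>The lattice \<open>\<int>\<^sup>d\<close> is \<open>int ^ 'd\<close>, with \<open>d = CARD('d)\<close>; the basis vector \<open>e\<^sub>i\<close> is \<open>axis i 1\<close>.\<close>

definition norm_inf :: "int ^ 'd::finite \<Rightarrow> real" where
  "norm_inf k = real_of_int (MAX i. \<bar>k $ i\<bar>)"

definition norm_one :: "int ^ 'd::finite \<Rightarrow> real" where
  "norm_one k = real_of_int (\<Sum>i\<in>UNIV. \<bar>k $ i\<bar>)"

definition finite_second_moments :: "(int ^ 'd::finite) pmf \<Rightarrow> bool" where
  "finite_second_moments q \<longleftrightarrow>
     (\<forall>i. integrable (measure_pmf q) (\<lambda>k. (real_of_int (k $ i))\<^sup>2))"

definition mean_pmf :: "(int ^ 'd::finite) pmf \<Rightarrow> real ^ 'd" where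
  "mean_pmf q = (\<chi> i. measure_pmf.expectation q (\<lambda>k. real_of_int (k $ i)))"

definition Cov :: "(int ^ 'd::finite) pmf \<Rightarrow> real ^ 'd ^ 'd" where
  "Cov q = (\<chi> i j. measure_pmf.expectation q
     (\<lambda>k. (real_of_int (k $ i) - mean_pmf q $ i) * (real_of_int (k $ j) - mean_pmf q $ j)))"

definition sigma_pmf :: "(int ^ 'd::finite) pmf \<Rightarrow> real" where
  "sigma_pmf q = det (Cov q) powr (1 / (2 * real CARD('d)))"

text \<open>The sum over \<open>k\<close> in the last condition always converges, see \<open>summable_pmf_diff\<close> below,
  so the value that \<open>infsum\<close> takes on divergent sums plays no role.\<close>

definition pmf_class :: "real \<Rightarrow> real \<Rightarrow> real \<Rightarrow> (int ^ 'd::finite) pmf set" where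
  "pmf_class c1 c2 c3 = {q. finite_second_moments q \<and> sigma_pmf q > 0 \<and>
     (\<forall>k. pmf q k \<le> c1 / sigma_pmf q ^ CARD('d)) \<and>
     (\<forall>k. norm_inf k \<ge> c2 * sigma_pmf q \<longrightarrow>
        pmf q k \<le> c2 / sigma_pmf q ^ CARD('d) * exp (- (norm_one k / (c2 * sigma_pmf q)))) \<and>
     (\<Sum>i\<in>UNIV. \<Sum>\<^sub>\<infinity>k. \<bar>pmf q k - pmf q (k - axis i 1)\<bar>) \<le> c3 / sigma_pmf q}"

definition conv_pmf :: "('a::ab_group_add) pmf \<Rightarrow> 'a pmf \<Rightarrow> 'a pmf" where
  "conv_pmf p q = map_pmf (\<lambda>(x, y). x + y) (pair_pmf p q)"

text \<open>The empty convolution is the point mass at \<open>0\<close>, the unit for \<open>conv_pmf\<close>.\<close>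

primrec conv_power :: "nat \<Rightarrow> ('a::ab_group_add) pmf \<Rightarrow> 'a pmf" where
  "conv_power 0 p = return_pmf 0"
| "conv_power (Suc n) p = conv_pmf p (conv_power n p)"

lemma summable_pmf: "pmf q summable_on UNIV"
  using abs_summable_equivalent abs_summable_summable pmf_abs_summable by blast

lemma summable_pmf_diff:
  fixes q :: "(int ^ 'd::finite) pmf"
  shows "(\<lambda>k. \<bar>pmf q k - pmf q (k - e)\<bar>) summable_on UNIV"
proof -
  have "bij (\<lambda>k :: int ^ 'd. k - e)"
    by (rule bij_betw_byWitness[where f' = "\<lambda>k. k + e"]) auto
  then have "(\<lambda>k. pmf q (k - e)) summable_on UNIV"
    using summable_on_reindex_bij_betw[of "\<lambda>k. k - e" UNIV UNIV "pmf q"] summable_pmf[of q] by simp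
  then have "(\<lambda>k. pmf q k + pmf q (k - e)) summable_on UNIV"
    by (intro summable_on_add summable_pmf)
  then show ?thesis
    by (rule summable_on_comparison_test) (auto simp: abs_le_iff add_increasing add_increasing2)
qed

lemma pmf_conv_pmf: "pmf (conv_pmf p q) k = (\<Sum>\<^sub>\<infinity>j. pmf p j * pmf q (k - j))"
proof -
  have "conv_pmf p q = bind_pmf p (\<lambda>x. map_pmf ((+) x) q)"
    by (simp add: conv_pmf_def pair_pmf_def map_bind_pmf map_pmf_def bind_assoc_pmf bind_return_pmf)
  moreover have "pmf (map_pmf ((+) x) q) k = pmf q (k - x)" for x
    using pmf_map_inj'[of "(+) x" q "k - x"] by (simp add: inj_on_def)
  ultimately have "pmf (conv_pmf p q) k = measure_pmf.expectation p (\<lambda>j. pmf q (k - j))"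
    by (simp add: pmf_bind)
  also have "\<dots> = infsetsum (\<lambda>j. pmf p j * pmf q (k - j)) UNIV"
    by (simp add: pmf_expectation_eq_infsetsum)
  also have "\<dots> = (\<Sum>\<^sub>\<infinity>j. pmf p j * pmf q (k - j))"
  proof (rule infsetsum_infsum)
    show "Infinite_Set_Sum.abs_summable_on (\<lambda>j. pmf p j * pmf q (k - j)) UNIV"
      by (rule abs_summable_on_comparison_test[OF pmf_abs_summable[of p]])
        (simp add: mult_left_le pmf_le_1)
  qed
  finally show ?thesis .
qed

lemma conv_power_1: "conv_power 1 p = p"
  by (simp add: conv_pmf_def pair_return_pmf2 map_pmf_comp)

end

theory Submission
  imports Defs
begin

text \<open>Covariances add under convolution, so \<open>\<sigma>(p\<^sub>n) = \<surd>n \<sigma>(p)\<close>. The sup bound and the total variation bound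
  survive averaging over translates. For the tail, if \<open>k = j + (k - j)\<close> then one of the summands has
  \<open>\<ell>\<^sup>1\<close>-norm at least \<open>\<parallel>k\<parallel>\<^sub>1 / 2\<close>, hence sup norm at least \<open>\<parallel>k\<parallel>\<^sub>\<infinity> / (2d)\<close>, and the tail bound
  applies to it; a convolution with \<open>p\<close> thus costs only a factor \<open>2d\<close> in the tail constant.\<close>

section \<open>Convolution as an average of translates: supremum and variation\<close>

lemma has_sum_pmf: "(pmf q has_sum 1) UNIV"
proof -
  have "infsum (pmf q) UNIV = 1"
    using infsetsum_infsum[OF pmf_abs_summable[of q UNIV]] infsetsum_pmf_eq_1[of q UNIV] by simp
  then show ?thesis
    using summable_pmf[of q] by (simp add: has_sum_iff)
qed

lemma has_sum_minus_shift:
  fixes f :: "'a::ab_group_add \<Rightarrow> real"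
  shows "((\<lambda>k. f (k - e)) has_sum S) UNIV \<longleftrightarrow> (f has_sum S) UNIV"
    and "((\<lambda>k. f (e - k)) has_sum S) UNIV \<longleftrightarrow> (f has_sum S) UNIV"
proof -
  have "bij (\<lambda>k. k - e)"
    by (rule bij_betw_byWitness[where f' = "\<lambda>k. k + e"]) auto
  then show "((\<lambda>k. f (k - e)) has_sum S) UNIV \<longleftrightarrow> (f has_sum S) UNIV"
    by (rule has_sum_reindex_bij_betw)
  have "bij (\<lambda>k. e - k)"
    by (rule bij_betw_byWitness[where f' = "\<lambda>k. e - k"]) auto
  then show "((\<lambda>k. f (e - k)) has_sum S) UNIV \<longleftrightarrow> (f has_sum S) UNIV"
    by (rule has_sum_reindex_bij_betw)
qed

lemma has_sum_conv_pmf: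
  "((\<lambda>j. pmf p j * pmf q (k - j)) has_sum pmf (conv_pmf p q) k) UNIV"
proof -
  have "(\<lambda>j. pmf p j * pmf q (k - j)) summable_on UNIV"
    by (rule summable_on_comparison_test[OF summable_pmf[of p]]) (auto simp: mult_left_le pmf_le_1)
  then show ?thesis
    by (simp add: pmf_conv_pmf)
qed

text \<open>Each value of the convolution is an average of values of \<open>q\<close> with weights
  \<open>pmf p j\<close> of total mass 1, so it cannot exceed a bound for \<open>q\<close>.\<close>

lemma pmf_conv_pmf_le:
  assumes "\<And>k. pmf q k \<le> M"
  shows "pmf (conv_pmf p q) k \<le> M"
proof -
  have "((\<lambda>j. pmf p j * M) has_sum 1 * M) UNIV"
    by (rule has_sum_cmult_left[OF has_sum_pmf])
  then show ?thesis
    using has_sum_mono[OF has_sum_conv_pmf[of p q k]] assms by (simp add: mult_left_mono)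
qed

text \<open>The shift by \<open>e\<close> can be put entirely on \<open>q\<close>, so the difference
  of the convolution is the \<open>p\<close>-average of translated differences of \<open>q\<close>.
  The triangle inequality under the sum and an exchange of the two sums then give the bound, because
  each translate has the same total variation.\<close>

lemma variation_conv_pmf_le:
  fixes p q :: "(int ^ 'd::finite) pmf"
  shows "(\<Sum>\<^sub>\<infinity>k. \<bar>pmf (conv_pmf p q) k - pmf (conv_pmf p q) (k - e)\<bar>)
    \<le> (\<Sum>\<^sub>\<infinity>k. \<bar>pmf q k - pmf q (k - e)\<bar>)"
proof -
  define g where "g k = \<bar>pmf q k - pmf q (k - e)\<bar>" for k
  define V where "V = infsum g UNIV"
  have g: "(g has_sum V) UNIV"
    unfolding V_def g_def using summable_pmf_diff by (rule has_sum_infsum)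
  have row: "((\<lambda>k. pmf p j * g (k - j)) has_sum pmf p j * V) UNIV" for j
    using g by (intro has_sum_cmult_right) (simp add: has_sum_minus_shift)
  have total: "((\<lambda>j. pmf p j * V) has_sum V) UNIV"
    using has_sum_cmult_left[OF has_sum_pmf[of p], of V] by simp
  \<comment> \<open>All terms are nonnegative, so summable rows with summable row totals give joint
    summability.\<close>
  have joint: "(\<lambda>(j, k). pmf p j * g (k - j)) summable_on UNIV \<times> UNIV"
    by (rule summable_on_SigmaI[where g = "\<lambda>j. pmf p j * V"])
      (use row total in \<open>auto simp: g_def summable_on_def\<close>)
  \<comment> \<open>The same family with \<open>k\<close> as outer index, the order in which the
    convolution presents the double sum.\<close>
  have joint': "(\<lambda>(k, j). pmf p j * g (k - j)) summable_on UNIV \<times> UNIV"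
    using joint summable_on_reindex_bij_betw[OF bij_swap, of "\<lambda>(j, k). pmf p j * g (k - j)"]
    by (simp add: case_prod_unfold prod.swap_def)
  have col: "(\<lambda>j. pmf p j * g (k - j)) summable_on UNIV" for k
    using summable_on_SigmaD1[OF joint'] by simp
  have "(\<Sum>\<^sub>\<infinity>k. \<bar>pmf (conv_pmf p q) k - pmf (conv_pmf p q) (k - e)\<bar>)
    \<le> (\<Sum>\<^sub>\<infinity>k. \<Sum>\<^sub>\<infinity>j. pmf p j * g (k - j))"
  proof (rule infsum_mono[OF summable_pmf_diff])
    show "(\<lambda>k. \<Sum>\<^sub>\<infinity>j. pmf p j * g (k - j)) summable_on UNIV"
      using summable_on_Sigma_banach[OF joint'] by simp
    fix k
    let ?u = "\<lambda>j. pmf p j * pmf q (k - j) - pmf p j * pmf q (k - e - j)"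
    have u: "(?u has_sum pmf (conv_pmf p q) k - pmf (conv_pmf p q) (k - e)) UNIV"
      using has_sum_add[OF has_sum_conv_pmf[of p q k] has_sum_uminusI[OF has_sum_conv_pmf[of p q "k - e"]]]
      by simp
    have abs_u: "norm (?u j) = pmf p j * g (k - j)" for j
      by (simp add: g_def abs_mult cancel_ab_semigroup_add_class.diff_right_commute[of k e] right_diff_distrib[symmetric])
    show "\<bar>pmf (conv_pmf p q) k - pmf (conv_pmf p q) (k - e)\<bar> \<le> (\<Sum>\<^sub>\<infinity>j. pmf p j * g (k - j))"
      using norm_infsum_bound[of ?u UNIV] infsumI[OF u] col[of k] by (simp only: abs_u) simp
  qed
  also have "\<dots> = (\<Sum>\<^sub>\<infinity>j. \<Sum>\<^sub>\<infinity>k. pmf p j * g (k - j))"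
    by (rule infsum_swap_banach[OF joint'])
  also have "\<dots> = V"
    using infsumI[OF row] infsumI[OF total] by simp
  finally show ?thesis
    unfolding V_def g_def .
qed

section \<open>Lattice norms and exponential tails\<close>

lemma norm_one_triangle: "norm_one k \<le> norm_one j + norm_one (k - j)"
  unfolding norm_one_def of_int_add[symmetric] of_int_le_iff sum.distrib[symmetric]
  by (rule sum_mono) auto

lemma norm_inf_le_norm_one: "norm_inf k \<le> norm_one k"
  unfolding norm_inf_def norm_one_def of_int_le_iff
  by (auto intro!: member_le_sum)

lemma norm_one_le_norm_inf: "norm_one (k :: int ^ 'd::finite) \<le> real CARD('d) * norm_inf k"
proof -
  have "(\<Sum>i\<in>UNIV. \<bar>k $ i\<bar>) \<le> of_nat CARD('d) * (MAX i. \<bar>k $ i\<bar>)"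
    by (rule sum_bounded_above) auto
  then have "real_of_int (\<Sum>i\<in>UNIV. \<bar>k $ i\<bar>) \<le> real_of_int (of_nat CARD('d) * (MAX i. \<bar>k $ i\<bar>))"
    by (simp only: of_int_le_iff)
  then show ?thesis
    by (simp add: norm_one_def norm_inf_def)
qed

text \<open>Condition (ii) of the class with the scale \<open>s\<close> kept independent of
  \<open>q\<close>: the induction measures every convolution power at the scale of \<open>p\<close>,
  not at its own.\<close>

definition tail_bound :: "real \<Rightarrow> real \<Rightarrow> (int ^ 'd::finite) pmf \<Rightarrow> bool" where
  "tail_bound c s q \<longleftrightarrow> (\<forall>k. norm_inf k \<ge> c * s \<longrightarrow>
     pmf q k \<le> c / s ^ CARD('d) * exp (- (norm_one k / (c * s))))"

lemma norm_one_nonneg: "norm_one k \<ge> 0"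
  unfolding norm_one_def of_int_0_le_iff by (rule sum_nonneg) simp

text \<open>A larger constant weakens the bound in every place where it occurs: the threshold rises,
  the prefactor grows and the exponential decays more slowly.\<close>

lemma tail_bound_mono:
  fixes q :: "(int ^ 'd::finite) pmf"
  assumes "tail_bound b s q" and "0 < b" and "b \<le> c" and "s > 0"
  shows "tail_bound c s q"
  unfolding tail_bound_def
proof (intro allI impI)
  fix k :: "int ^ 'd"
  assume "norm_inf k \<ge> c * s"
  moreover have "b * s \<le> c * s"
    using assms by simp
  ultimately have "pmf q k \<le> b / s ^ CARD('d) * exp (- (norm_one k / (b * s)))"
    using assms(1) by (simp add: tail_bound_def)
  also have "\<dots> \<le> c / s ^ CARD('d) * exp (- (norm_one k / (c * s)))"
    using assms by (intro mult_mono) (auto intro!: divide_right_mono divide_left_mono norm_one_nonneg)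
  finally show "pmf q k \<le> c / s ^ CARD('d) * exp (- (norm_one k / (c * s)))" .
qed

text \<open>In the factor \<open>2 * real CARD('d)\<close>, the 2 comes from halving the norm of
  \<open>k\<close>, the dimension from comparing the two norms.\<close>

lemma tail_bound_conv_pmf:
  fixes p q :: "(int ^ 'd::finite) pmf"
  assumes p: "tail_bound b s p" and q: "tail_bound b s q" and b: "b > 0" and s: "s > 0"
    and c: "2 * real CARD('d) * b \<le> c"
  shows "tail_bound c s (conv_pmf p q)"
proof -
  have d: "1 \<le> real CARD('d)"
    by (simp add: Suc_leI)
  have "2 * 1 * b \<le> 2 * real CARD('d) * b"
    using d b by (intro mult_right_mono mult_left_mono) auto
  then have bc: "2 * b \<le> c"
    using c by simp
  show ?thesis
    unfolding tail_bound_def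
  proof (intro allI impI)
    fix k :: "int ^ 'd"
    assume k: "norm_inf k \<ge> c * s"
    \<comment> \<open>The tail bound with constant \<open>b\<close> evaluated at half the norm of
      \<open>k\<close>.\<close>
    define B where "B = b / s ^ CARD('d) * exp (- (norm_one k / (2 * b * s)))"
    have B: "B \<ge> 0"
      using b s by (simp add: B_def)
    have half: "pmf r l \<le> B"
      if r: "tail_bound b s r" and l: "norm_one k \<le> 2 * norm_one l" for r and l :: "int ^ 'd"
    proof -
      \<comment> \<open>This chain puts \<open>l\<close> beyond the threshold \<open>b * s\<close>,
        so that the tail bound for \<open>r\<close> applies to it.\<close>
      have "2 * real CARD('d) * (b * s) \<le> c * s"
        using mult_right_mono[OF c, of s] s by (simp add: mult.assoc)
      also have "\<dots> \<le> norm_one k"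
        using k norm_inf_le_norm_one by (rule order_trans)
      also have "\<dots> \<le> 2 * real CARD('d) * norm_inf l"
        using l norm_one_le_norm_inf[of l] by simp
      finally have "b * s \<le> norm_inf l"
        using d by simp
      then have "pmf r l \<le> b / s ^ CARD('d) * exp (- (norm_one l / (b * s)))"
        using r by (simp add: tail_bound_def)
      also have "\<dots> \<le> B"
        unfolding B_def using l b s by (intro mult_left_mono) (auto simp: field_simps)
      finally show ?thesis .
    qed
    \<comment> \<open>One of the two factors is at most \<open>B\<close>, depending on which summand
      is long. Adding both alternatives removes the case distinction, and each sums to
      \<open>B\<close> over \<open>j\<close>.\<close>
    have le: "pmf p j * pmf q (k - j) \<le> B * pmf p j + B * pmf q (k - j)" for j
    proof (cases "norm_one k \<le> 2 * norm_one j")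
      case True
      then have "pmf p j * pmf q (k - j) \<le> B * pmf q (k - j)"
        using half[OF p] by (intro mult_right_mono) auto
      then show ?thesis
        using B by (simp add: add_increasing)
    next
      case False
      then have "pmf q (k - j) \<le> B"
        using norm_one_triangle[of k j] by (intro half[OF q]) simp
      then have "pmf p j * pmf q (k - j) \<le> B * pmf p j"
        by (subst mult.commute) (intro mult_right_mono, auto)
      then show ?thesis
        using B by (simp add: add_increasing2)
    qed
    have "((\<lambda>j. B * pmf p j + B * pmf q (k - j)) has_sum B * 1 + B * 1) UNIV"
      by (intro has_sum_add has_sum_cmult_right) (simp_all add: has_sum_minus_shift has_sum_pmf)
    then have "pmf (conv_pmf p q) k \<le> 2 * B"
      using has_sum_mono[OF has_sum_conv_pmf[of p q k]] le by simp
    \<comment> \<open>The doubled prefactor and the halved exponent together are exactly the tail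
      expression with constant \<open>2 * b\<close>.\<close>
    also have "\<dots> = 2 * b / s ^ CARD('d) * exp (- (norm_one k / (2 * b * s)))"
      by (simp add: B_def)
    also have "\<dots> \<le> c / s ^ CARD('d) * exp (- (norm_one k / (c * s)))"
      using b s bc norm_one_nonneg[of k]
      by (intro mult_mono) (auto intro!: divide_right_mono divide_left_mono)
    finally show "pmf (conv_pmf p q) k \<le> c / s ^ CARD('d) * exp (- (norm_one k / (c * s)))" .
  qed
qed

section \<open>Expectations as lattice sums, and independence\<close>

lemma integrable_pmf_iff_abs_summable:
  fixes f :: "'a \<Rightarrow> real"
  shows "integrable (measure_pmf p) f \<longleftrightarrow> (\<lambda>x. norm (pmf p x * f x)) summable_on UNIV"
proof -
  have "integrable (measure_pmf p) f \<longleftrightarrow> integrable (count_space UNIV) (\<lambda>x. pmf p x * f x)"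
    unfolding measure_pmf_eq_density by (subst integrable_density) simp_all
  then show ?thesis
    by (simp only: Infinite_Set_Sum.abs_summable_on_def[symmetric] abs_summable_equivalent)
qed

lemma has_sum_expectation:
  fixes f :: "'a \<Rightarrow> real"
  assumes "integrable (measure_pmf p) f"
  shows "((\<lambda>x. pmf p x * f x) has_sum measure_pmf.expectation p f) UNIV"
proof -
  have *: "(\<lambda>x. norm (pmf p x * f x)) summable_on UNIV"
    using assms by (simp only: integrable_pmf_iff_abs_summable)
  then have "measure_pmf.expectation p f = (\<Sum>\<^sub>\<infinity>x. pmf p x * f x)"
    unfolding pmf_expectation_eq_infsetsum
    by (intro infsetsum_infsum) (simp only: abs_summable_equivalent[symmetric])
  then show ?thesis
    using has_sum_infsum[OF abs_summable_summable[OF *]] by simp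
qed

text \<open>Independence for product functions: after translation into sums, the summand factors as
  \<open>u (fst z) * v (snd z)\<close>, and summing rows first gives the product of the two sums.
  The absolute values are treated first, which yields integrability.\<close>

lemma
  fixes f :: "'a \<Rightarrow> real" and g :: "'b \<Rightarrow> real"
  assumes f: "integrable (measure_pmf p) f" and g: "integrable (measure_pmf q) g"
  shows integrable_pair_pmf_mult: "integrable (measure_pmf (pair_pmf p q)) (\<lambda>z. f (fst z) * g (snd z))"
    and expectation_pair_pmf_mult: "measure_pmf.expectation (pair_pmf p q) (\<lambda>z. f (fst z) * g (snd z)) =
      measure_pmf.expectation p f * measure_pmf.expectation q g"
proof -
  define u where "u x = pmf p x * f x" for x
  define v where "v y = pmf q y * g y" for y
  have uv: "pmf (pair_pmf p q) z * (f (fst z) * g (snd z)) = u (fst z) * v (snd z)" for z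
    by (cases z) (simp add: pmf_pair u_def v_def)
  have "(\<lambda>z. norm (u (fst z) * v (snd z))) summable_on (UNIV \<times> UNIV)"
  proof (rule summable_on_SigmaI)
    show "((\<lambda>y. norm (u (fst (x, y)) * v (snd (x, y)))) has_sum norm (u x) * (\<Sum>\<^sub>\<infinity>y. norm (v y))) UNIV" for x
      unfolding norm_mult fst_conv snd_conv
      using g by (intro has_sum_cmult_right has_sum_infsum)
        (simp only: integrable_pmf_iff_abs_summable v_def)
    show "(\<lambda>x. norm (u x) * (\<Sum>\<^sub>\<infinity>y. norm (v y))) summable_on UNIV"
      using f by (intro summable_on_cmult_left) (simp only: integrable_pmf_iff_abs_summable u_def)
  qed simp
  then have abs: "(\<lambda>z. norm (u (fst z) * v (snd z))) summable_on UNIV"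
    by simp
  then show int: "integrable (measure_pmf (pair_pmf p q)) (\<lambda>z. f (fst z) * g (snd z))"
    by (simp only: integrable_pmf_iff_abs_summable uv)
  have "((\<lambda>z. u (fst z) * v (snd z)) has_sum
      measure_pmf.expectation p f * measure_pmf.expectation q g) (UNIV \<times> UNIV)"
  proof (rule has_sum_SigmaI)
    show "((\<lambda>y. u (fst (x, y)) * v (snd (x, y))) has_sum u x * measure_pmf.expectation q g) UNIV" for x
      unfolding fst_conv snd_conv v_def by (intro has_sum_cmult_right has_sum_expectation g)
    show "((\<lambda>x. u x * measure_pmf.expectation q g) has_sum
        measure_pmf.expectation p f * measure_pmf.expectation q g) UNIV"
      unfolding u_def by (intro has_sum_cmult_left has_sum_expectation f)
    show "(\<lambda>z. u (fst z) * v (snd z)) summable_on (UNIV \<times> UNIV)"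
      using abs_summable_summable[OF abs] by simp
  qed
  then show "measure_pmf.expectation (pair_pmf p q) (\<lambda>z. f (fst z) * g (snd z)) =
      measure_pmf.expectation p f * measure_pmf.expectation q g"
    using has_sum_expectation[OF int] unfolding uv by (auto intro: has_sum_unique)
qed

text \<open>The case of the product rule in which the other factor is the constant 1.\<close>

lemma
  fixes f :: "'a \<Rightarrow> real" and g :: "'b \<Rightarrow> real"
  shows integrable_pair_pmf_fst:
      "integrable (measure_pmf p) f \<Longrightarrow> integrable (measure_pmf (pair_pmf p q)) (\<lambda>z. f (fst z))"
    and integrable_pair_pmf_snd:
      "integrable (measure_pmf q) g \<Longrightarrow> integrable (measure_pmf (pair_pmf p q)) (\<lambda>z. g (snd z))"
  using integrable_pair_pmf_mult[of p f q "\<lambda>_. 1"] integrable_pair_pmf_mult[of p "\<lambda>_. 1" q g]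
  by simp_all

section \<open>Moments and covariance of a convolution\<close>

lemma finite_second_moments_coordinate:
  assumes "finite_second_moments q"
  shows "integrable (measure_pmf q) (\<lambda>k. real_of_int (k $ i))"
proof (rule Bochner_Integration.integrable_bound)
  show "integrable (measure_pmf q) (\<lambda>k. 1 + (real_of_int (k $ i))\<^sup>2)"
    using assms by (auto simp: finite_second_moments_def)
  have "\<bar>x\<bar> \<le> 1 + x\<^sup>2" for x :: real
    using sum_squares_bound[of "\<bar>x\<bar>" 1] by simp
  then show "AE k in measure_pmf q. norm (real_of_int (k $ i)) \<le> norm (1 + (real_of_int (k $ i))\<^sup>2)"
    by simp
qed simp

text \<open>Second moments dominate the product of two coordinates through
  \<open>\<bar>x * y\<bar> \<le> x\<^sup>2 + y\<^sup>2\<close>; centering by \<open>a\<close> and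
  \<open>b\<close> only adds first-order and constant terms.\<close>

lemma finite_second_moments_mixed:
  assumes "finite_second_moments q"
  shows "integrable (measure_pmf q) (\<lambda>k. (real_of_int (k $ i) - a) * (real_of_int (k $ j) - b))"
proof -
  have "integrable (measure_pmf q) (\<lambda>k. real_of_int (k $ i) * real_of_int (k $ j))"
  proof (rule Bochner_Integration.integrable_bound)
    show "integrable (measure_pmf q) (\<lambda>k. (real_of_int (k $ i))\<^sup>2 + (real_of_int (k $ j))\<^sup>2)"
      using assms by (auto simp: finite_second_moments_def)
    have "\<bar>x * y\<bar> \<le> x\<^sup>2 + y\<^sup>2" for x y :: real
      using sum_squares_bound[of "\<bar>x\<bar>" "\<bar>y\<bar>"] abs_ge_zero[of "x * y"]
      unfolding abs_mult power2_abs by linarith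
    then show "AE k in measure_pmf q. norm (real_of_int (k $ i) * real_of_int (k $ j))
        \<le> norm ((real_of_int (k $ i))\<^sup>2 + (real_of_int (k $ j))\<^sup>2)"
      by simp
  qed simp
  then show ?thesis
    using finite_second_moments_coordinate[OF assms]
    by (simp add: left_diff_distrib right_diff_distrib)
qed

lemma finite_second_moments_conv_pmf:
  assumes p: "finite_second_moments p" and q: "finite_second_moments q"
  shows "finite_second_moments (conv_pmf p q)"
  unfolding finite_second_moments_def conv_pmf_def integrable_map_pmf_eq
proof
  fix i
  have "integrable (measure_pmf (pair_pmf p q))
    (\<lambda>z. (real_of_int (fst z $ i))\<^sup>2 + (real_of_int (snd z $ i))\<^sup>2
      + 2 * (real_of_int (fst z $ i) * real_of_int (snd z $ i)))"
    using p q
    by (intro Bochner_Integration.integrable_add integrable_mult_right integrable_pair_pmf_mult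
        integrable_pair_pmf_fst[where f = "\<lambda>k. (real_of_int (k $ i))\<^sup>2"]
        integrable_pair_pmf_snd[where g = "\<lambda>k. (real_of_int (k $ i))\<^sup>2"]
        finite_second_moments_coordinate) (auto simp: finite_second_moments_def)
  then show "integrable (measure_pmf (pair_pmf p q)) (\<lambda>z. (real_of_int ((case z of (x, y) \<Rightarrow> x + y) $ i))\<^sup>2)"
    by (simp add: case_prod_unfold power2_sum mult.assoc)
qed

lemma mean_pmf_conv_pmf:
  assumes "finite_second_moments p" and "finite_second_moments q"
  shows "mean_pmf (conv_pmf p q) = mean_pmf p + mean_pmf q"
proof -
  have "measure_pmf.expectation (pair_pmf p q) (\<lambda>z. real_of_int (fst z $ i) + real_of_int (snd z $ i))
    = measure_pmf.expectation p (\<lambda>k. real_of_int (k $ i)) + measure_pmf.expectation q (\<lambda>k. real_of_int (k $ i))" for i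
    using assms by (subst Bochner_Integration.integral_add)
      (auto intro: integrable_pair_pmf_fst[where f = "\<lambda>k. real_of_int (k $ i)"]
        integrable_pair_pmf_snd[where g = "\<lambda>k. real_of_int (k $ i)"] finite_second_moments_coordinate
        simp: expectation_pair_pmf_fst[where f = "\<lambda>k. real_of_int (k $ i)"]
          expectation_pair_pmf_snd[where f = "\<lambda>k. real_of_int (k $ i)"])
  then show ?thesis
    by (simp add: vec_eq_iff mean_pmf_def conv_pmf_def case_prod_unfold)
qed

lemma expectation_centered:
  assumes "finite_second_moments p"
  shows "measure_pmf.expectation p (\<lambda>k. real_of_int (k $ i) - mean_pmf p $ i) = 0"
  using finite_second_moments_coordinate[OF assms] by (simp add: mean_pmf_def)

text \<open>With centered coordinates \<open>X\<close> and \<open>Y\<close>, the product of the sums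
  expands into four terms; by independence the two mixed ones have expectation zero.\<close>

lemma Cov_conv_pmf:
  assumes p: "finite_second_moments p" and q: "finite_second_moments q"
  shows "Cov (conv_pmf p q) = Cov p + Cov q"
proof -
  define X where "X i k = real_of_int (k $ i) - mean_pmf p $ i" for i and k :: "int ^ 'a"
  define Y where "Y i k = real_of_int (k $ i) - mean_pmf q $ i" for i and k :: "int ^ 'a"
  have X: "integrable (measure_pmf p) (X i)" "measure_pmf.expectation p (X i) = 0"
      "integrable (measure_pmf p) (\<lambda>k. X i k * X j k)" for i j
    using expectation_centered[OF p] finite_second_moments_coordinate[OF p]
      finite_second_moments_mixed[OF p] by (auto simp: X_def[abs_def])
  have Y: "integrable (measure_pmf q) (Y i)" "measure_pmf.expectation q (Y i) = 0"
      "integrable (measure_pmf q) (\<lambda>k. Y i k * Y j k)" for i j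
    using expectation_centered[OF q] finite_second_moments_coordinate[OF q]
      finite_second_moments_mixed[OF q] by (auto simp: Y_def[abs_def])
  have "measure_pmf.expectation (pair_pmf p q)
      (\<lambda>z. (X i (fst z) + Y i (snd z)) * (X j (fst z) + Y j (snd z)))
    = measure_pmf.expectation p (\<lambda>k. X i k * X j k) + measure_pmf.expectation q (\<lambda>k. Y i k * Y j k)"
    (is "?L = ?R") for i j
  proof -
    note ints = integrable_pair_pmf_fst[OF X(3), of q i j] integrable_pair_pmf_snd[OF Y(3), of p i j]
      integrable_pair_pmf_mult[OF X(1) Y(1), of i j] integrable_pair_pmf_mult[OF X(1) Y(1), of j i]
    have "?L = measure_pmf.expectation (pair_pmf p q) (\<lambda>z. X i (fst z) * X j (fst z)
        + Y i (snd z) * Y j (snd z) + X i (fst z) * Y j (snd z) + X j (fst z) * Y i (snd z))"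
      by (simp add: algebra_simps)
    also have "\<dots> = ?R"
      using ints
      by (simp add: expectation_pair_pmf_mult[OF X(1) Y(1)] X(2)
          expectation_pair_pmf_fst[where f = "\<lambda>k. X i k * X j k"]
          expectation_pair_pmf_snd[where f = "\<lambda>k. Y i k * Y j k"])
    finally show ?thesis .
  qed
  \<comment> \<open>Means add under convolution, so the centered coordinate of a sum is the sum of
    the centered coordinates.\<close>
  moreover have "measure_pmf.expectation (conv_pmf p q)
      (\<lambda>k. (real_of_int (k $ i) - mean_pmf (conv_pmf p q) $ i) * (real_of_int (k $ j) - mean_pmf (conv_pmf p q) $ j))
    = measure_pmf.expectation (pair_pmf p q)
      (\<lambda>z. (X i (fst z) + Y i (snd z)) * (X j (fst z) + Y j (snd z)))" for i j
    unfolding mean_pmf_conv_pmf[OF p q]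
    by (simp add: conv_pmf_def case_prod_unfold X_def Y_def add_diff_add)
  ultimately show ?thesis
    by (simp add: vec_eq_iff Cov_def X_def Y_def)
qed

section \<open>Scale of convolution powers\<close>

lemma finite_second_moments_conv_power:
  assumes "finite_second_moments p"
  shows "finite_second_moments (conv_power n p)"
proof (induction n)
  case 0
  show ?case
    by (auto simp: finite_second_moments_def intro: integrable_measure_pmf_finite)
next
  case (Suc n)
  then show ?case
    by (simp add: finite_second_moments_conv_pmf assms)
qed

lemma Cov_conv_power:
  assumes "finite_second_moments p"
  shows "Cov (conv_power n p) = real n *\<^sub>R Cov p"
proof (induction n)
  case 0
  show ?case
    by (simp add: vec_eq_iff Cov_def mean_pmf_def)
next
  case (Suc n)
  then show ?case
    by (simp add: Cov_conv_pmf assms finite_second_moments_conv_power scaleR_left_distrib)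
qed

lemma det_scaleR:
  fixes A :: "real ^ 'n ^ 'n"
  shows "det (c *\<^sub>R A) = c ^ CARD('n) * det A"
  by (simp add: det_def prod.distrib sum_distrib_left mult_ac)

text \<open>The determinant of the covariance picks up \<open>n\<close> to the power of the
  dimension, and the exponent in \<open>sigma_pmf\<close> turns this into a square root.\<close>

lemma sigma_pmf_conv_power:
  fixes p :: "(int ^ 'd::finite) pmf"
  assumes "finite_second_moments p"
  shows "sigma_pmf (conv_power n p) = sqrt (real n) * sigma_pmf p"
proof -
  have "(real n ^ CARD('d)) powr (1 / (2 * real CARD('d))) = sqrt (real n)"
  \<comment> \<open>\<open>powr_realpow\<close> needs a positive base; for \<open>n = 0\<close> both
    sides are 0.\<close>
  proof (cases "n = 0")
    case False
    then have "real n ^ CARD('d) = real n powr real CARD('d)"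
      by (simp add: powr_realpow)
    then show ?thesis
      by (simp add: powr_powr powr_half_sqrt)
  qed simp
  then show ?thesis
    by (simp add: sigma_pmf_def Cov_conv_power[OF assms] det_scaleR powr_mult)
qed

section \<open>Bounds at the scale of \<open>p\<close>, then membership in the class\<close>

theorem proposition15:
  fixes p :: "(int ^ 'd::finite) pmf" and c1 c2 c3 :: real and n :: nat
  assumes "c1 > 0" and "c2 \<ge> 1" and "c3 > 0"
    and "p \<in> pmf_class c1 c2 c3"
    and "n \<ge> 1"
  shows "let d = CARD('d);
             s = sigma_pmf p;
             pn = conv_power n p;
             c2' = (3 * 4 ^ (d + 1) * c2) ^ (2 ^ n - 1)
         in pn \<in> pmf_class (real n powr (real d / 2) * c1) (real n powr (real d / 2) * c2') (sqrt (real n) * c3)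
          \<and> (\<forall>k. pmf pn k \<le> c1 / s ^ d)
          \<and> (\<forall>k. norm_inf k \<ge> c2' * s \<longrightarrow>
                pmf pn k \<le> c2' / s ^ d * exp (- (norm_one k / (c2' * s))))
          \<and> (\<Sum>i\<in>UNIV. \<Sum>\<^sub>\<infinity>k. \<bar>pmf pn k - pmf pn (k - axis i 1)\<bar>) \<le> c3 / s"
proof -
  define d where "d = CARD('d)"
  define s where "s = sigma_pmf p"
  define pn where "pn = conv_power n p"
  define A where "A = 3 * 4 ^ (d + 1) * c2"
  define C where "C m = A ^ (2 ^ m - 1)" for m :: nat
  define w where "w = real n powr (real d / 2)"
  have p: "finite_second_moments p" and s: "s > 0" and sup: "\<And>k. pmf p k \<le> c1 / s ^ d"
    and tail: "tail_bound c2 s p"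
    and var: "(\<Sum>i\<in>UNIV. \<Sum>\<^sub>\<infinity>k. \<bar>pmf p k - pmf p (k - axis i 1)\<bar>) \<le> c3 / s"
    using assms(4) by (auto simp: pmf_class_def tail_bound_def s_def d_def)
  \<comment> \<open>The aim is \<open>2 * real d \<le> A\<close>: one factor \<open>A\<close> then
    pays for one convolution.\<close>
  have "real d \<le> 2 ^ d"
    using of_nat_mono[OF less_imp_le[OF less_exp[of d]], where 'a = real] by simp
  also have "\<dots> \<le> (4 :: real) ^ d"
    by (rule power_mono) auto
  finally have "2 * real d \<le> 2 * 4 ^ d"
    by simp
  also have "\<dots> \<le> (3 * 4 ^ (d + 1) :: real)"
    by simp
  also have "\<dots> \<le> A"
    using mult_left_mono[OF assms(2), of "3 * 4 ^ (d + 1)"] by (simp add: A_def)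
  finally have dA: "2 * real d \<le> A" .
  have "1 * c2 \<le> 3 * 4 ^ (d + 1) * c2"
    using assms(2) one_le_power[of "4 :: real" "d + 1"] by (intro mult_right_mono) auto
  then have c2A: "c2 \<le> A"
    by (simp add: A_def)
  then have A1: "1 \<le> A"
    using assms(2) by simp
  have C1: "1 \<le> C m" for m
    unfolding C_def using A1 by simp
  have step: "A * C m \<le> C (Suc m)" for m
  proof -
    \<comment> \<open>The left side is \<open>2 ^ m\<close>, the exponent of \<open>A * C m\<close>;
      the truncated subtraction is harmless because \<open>2 ^ m\<close> is at least 1.\<close>
    have "Suc (2 ^ m - 1) \<le> 2 ^ Suc m - (1 :: nat)"
      using one_le_power[of "2 :: nat" m] by simp
    then show ?thesis
      unfolding C_def power_Suc[symmetric] using A1 by (rule power_increasing)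
  qed
  \<comment> \<open>\<open>C 0\<close> is 1, so the comparison with \<open>c2\<close> starts at
    \<open>m = 1\<close>, where \<open>C m\<close> is \<open>A\<close>.\<close>
  have c2C: "c2 \<le> C m" if m: "1 \<le> m" for m
  proof -
    obtain l where l: "m = Suc l"
      using m by (cases m) auto
    have "A * 1 \<le> A * C l"
      using C1[of l] A1 by (intro mult_left_mono) auto
    also have "\<dots> \<le> C m"
      using step[of l] l by simp
    finally show ?thesis
      using c2A by simp
  qed

  have sup_n: "pmf pn k \<le> c1 / s ^ d" for k
    unfolding pn_def using assms(5)
  proof (induction n arbitrary: k rule: nat_induct_at_least)
    case base
    show ?case
      using sup by (simp only: conv_power_1)
  next
    case (Suc m)
    then show ?case
      by (simp add: pmf_conv_pmf_le)
  qed
  have tail_n: "tail_bound (C n) s pn"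
    unfolding pn_def using assms(5)
  proof (induction n rule: nat_induct_at_least)
    case base
    show ?case
      unfolding conv_power_1 by (rule tail_bound_mono[OF tail _ c2C]) (use assms(2) s in auto)
  next
    case (Suc m)
    have "2 * real CARD('d) * C m \<le> A * C m"
      using dA C1[of m] unfolding d_def by (intro mult_right_mono) auto
    also have "\<dots> \<le> C (Suc m)"
      by (rule step)
    finally have "2 * real CARD('d) * C m \<le> C (Suc m)" .
    moreover have "tail_bound (C m) s p"
      by (rule tail_bound_mono[OF tail _ c2C]) (use assms(2) s Suc.hyps in auto)
    moreover have "0 < C m"
      using C1[of m] by simp
    ultimately show ?case
      unfolding conv_power.simps using Suc.IH s by (metis tail_bound_conv_pmf)
  qed
  have var_n: "(\<Sum>i\<in>UNIV. \<Sum>\<^sub>\<infinity>k. \<bar>pmf pn k - pmf pn (k - axis i 1)\<bar>) \<le> c3 / s"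
    unfolding pn_def using assms(5)
  proof (induction n rule: nat_induct_at_least)
    case base
    show ?case
      using var by (simp only: conv_power_1)
  next
    case (Suc m)
    show ?case
      unfolding conv_power.simps
      by (rule order_trans[OF sum_mono Suc.IH]) (rule variation_conv_pmf_le)
  qed

  have n: "real n \<ge> 1"
    using assms(5) by simp
  have sigma: "sigma_pmf pn = sqrt (real n) * s"
    unfolding pn_def s_def using p by (rule sigma_pmf_conv_power)
  have w1: "1 \<le> w"
    unfolding w_def using n by (simp add: ge_one_powr_ge_zero)
  have "sqrt (real n) ^ d = sqrt (real n) powr real d"
    using n by (simp add: powr_realpow)
  also have "\<dots> = (real n powr (1 / 2)) powr real d"
    using n by (simp only: powr_half_sqrt)
  also have "\<dots> = w"
    by (simp add: w_def powr_powr)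
  finally have "sqrt (real n) ^ d = w" .
  then have sigma_d: "sigma_pmf pn ^ d = w * s ^ d"
    \<comment> \<open>The factor \<open>w\<close> in the constants of the class thus cancels against
      the growth of the scale.\<close>
    by (simp add: sigma power_mult_distrib)
  have sqrt1: "1 \<le> sqrt (real n)"
    using n by simp
  have tail_class: "pmf pn k \<le> w * C n / sigma_pmf pn ^ d * exp (- (norm_one k / (w * C n * sigma_pmf pn)))"
    if k: "norm_inf k \<ge> w * C n * sigma_pmf pn" for k
  proof -
    have pos: "0 < C n * s"
      using C1[of n] s by simp
    \<comment> \<open>Passing to the constant \<open>w * C n\<close> and the scale of
      \<open>pn\<close> multiplies the threshold by \<open>w * sqrt (real n)\<close>, which is at
      least 1. The same inequality slows the exponential decay, while the prefactor stays
      equal.\<close>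
    have "1 * (C n * s) \<le> (w * sqrt (real n)) * (C n * s)"
      using mult_mono[OF w1 sqrt1] w1 pos by (intro mult_right_mono) auto
    then have le: "C n * s \<le> w * C n * sigma_pmf pn"
      by (simp add: sigma mult_ac)
    have "pmf pn k \<le> C n / s ^ d * exp (- (norm_one k / (C n * s)))"
      using tail_n k le by (simp add: tail_bound_def d_def)
    also have "\<dots> \<le> C n / s ^ d * exp (- (norm_one k / (w * C n * sigma_pmf pn)))"
    proof (rule mult_left_mono)
      show "exp (- (norm_one k / (C n * s))) \<le> exp (- (norm_one k / (w * C n * sigma_pmf pn)))"
        using frac_le[OF norm_one_nonneg order_refl pos le] by simp
      show "0 \<le> C n / s ^ d"
        using C1[of n] s by simp
    qed
    also have "C n / s ^ d = w * C n / sigma_pmf pn ^ d"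
      using w1 by (simp add: sigma_d)
    finally show ?thesis .
  qed
  have "pn \<in> pmf_class (w * c1) (w * C n) (sqrt (real n) * c3)"
    unfolding pmf_class_def d_def[symmetric] mem_Collect_eq
  proof (intro conjI allI impI)
    show "finite_second_moments pn"
      unfolding pn_def using p by (rule finite_second_moments_conv_power)
    show "0 < sigma_pmf pn"
      using sigma s n by simp
    show "pmf pn k \<le> w * c1 / sigma_pmf pn ^ d" for k
      using sup_n[of k] w1 by (simp add: sigma_d)
    show "(\<Sum>i\<in>UNIV. \<Sum>\<^sub>\<infinity>k. \<bar>pmf pn k - pmf pn (k - axis i 1)\<bar>)
        \<le> sqrt (real n) * c3 / sigma_pmf pn"
      using var_n n by (simp add: sigma)
  qed (rule tail_class)
  then show ?thesis
    using sup_n tail_n var_n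
    unfolding Let_def tail_bound_def pn_def s_def C_def A_def w_def d_def by blast
qed

end
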